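(* Let $w=\log_2 3$. For every integer $k\ge 0$, $f(k)\le 2^{2^k-wk+3}-6$.
   Context: $\mu$ is the morphism on binary words with $\mu(0)=01$, $\mu(1)=10$; $\mu^n$ is its $n$-fold iterate. Words $CS(k)$, $k\ge 0$, are defined recursively: $CS(0)=0$ (the one-letter word). For $k\ge 1$, let $n=2^k$, $m=2^{k-1}$, $X=\mu^n(0)$, $Y=\mu^n(1)$, and write $X=x_0x_1\cdots x_{2^m-1}$, $Y=y_0y_1\cdots y_{2^m-1}$ as concatenations of $2^m$ consecutive blocks of length $2^m$ (each block is $\mu^m(0)$ or $\mu^m(1)$). For $0\le i<2^m-1$ define $cs_i=x_i$ if $i$ is even; if $i$ is odd, $cs_i=x_i$ when $x_i=y_{i+1}$ and $cs_i=CS(k-1)$ otherwise. Then $CS(k)=cs_0cs_1\cdots cs_{2^m-2}$ (a common subsequence of $\mu^{2^k}(0)$ and $\mu^{2^k}(1)$). Define $f(k)=2^{2^k}-|CS(k)|$. *)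

theory Defs
  imports Complex_Main "HOL-Library.Z2"
begin

text \<open>Binary words are lists over the two-element type \<^typ>\<open>bit\<close>, whose elements are 0 and 1.\<close>

definition mu :: "bit list \<Rightarrow> bit list" where
  "mu w = concat (map (\<lambda>a. if a = 0 then [0, 1] else [1, 0]) w)"

text \<open>The \<open>i\<close>-th of the consecutive length-\<open>l\<close> blocks of a word, counting from 0.\<close>

definition block :: "nat \<Rightarrow> 'a list \<Rightarrow> nat \<Rightarrow> 'a list" where
  "block l w i = take l (drop (i * l) w)"

primrec CS :: "nat \<Rightarrow> bit list" where
  "CS 0 = [0]"
| "CS (Suc k) =
    (let n = 2 ^ Suc k;
         m = 2 ^ k;
         x = block (2 ^ m) ((mu ^^ n) [0]);
         y = block (2 ^ m) ((mu ^^ n) [1]);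
         cs = (\<lambda>i. if even i then x i
                   else if x i = y (i + 1) then x i
                   else CS k)
     in concat (map cs [0..<2 ^ m - 1]))"

text \<open>The difference is taken in the integers, since subtraction of naturals truncates at 0.\<close>

definition f_CS :: "nat \<Rightarrow> int" where
  "f_CS k = 2 ^ (2 ^ k) - int (length (CS k))"

end

theory Submission
  imports Defs
begin

text \<open>
  Put \<open>B = 2 ^ 2 ^ k\<close>. In \<open>CS (k + 1)\<close> one of \<open>B\<close> blocks of length \<open>B\<close> is dropped, and \<open>c\<close> of
  the others are replaced by \<open>CS k\<close>, so \<open>f (k + 1) = B + c * f k\<close>. Here \<open>c\<close> counts the odd \<open>i\<close>
  for which the letters \<open>i\<close> and \<open>i + 1\<close> of the Thue-Morse word agree; as \<open>\<mu> v\<close> agrees at the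
  positions \<open>2 j + 1, 2 j + 2\<close> exactly when \<open>v\<close> changes between \<open>j\<close> and \<open>j + 1\<close>, \<open>c\<close> is the number
  of letter changes in the Thue-Morse prefix of length \<open>B / 2\<close>, which is about two thirds of
  that length. Hence \<open>3 * c \<le> B\<close>, and the term \<open>- 6\<close> of the bound becomes \<open>- 2 * B\<close>, which
  absorbs the summand \<open>B\<close> as soon as \<open>B \<ge> 6\<close>.
\<close>

lemma mu_Nil [simp]: "mu [] = []"
  by (simp add: mu_def)

lemma mu_Cons [simp]: "mu (a # w) = a # (a + 1) # mu w"
  by (cases a) (simp_all add: mu_def)

lemma length_mu [simp]: "length (mu w) = 2 * length w"
  by (induction w) simp_all

lemma mu_append: "mu (u @ v) = mu u @ mu v"
  by (simp add: mu_def)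

lemma mu_pow_Nil [simp]: "(mu ^^ p) [] = []"
  by (induction p) simp_all

lemma mu_pow_append: "(mu ^^ p) (u @ v) = (mu ^^ p) u @ (mu ^^ p) v"
  by (induction p) (simp_all add: mu_append)

lemma mu_pow_conv_concat: "(mu ^^ p) w = concat (map (\<lambda>a. (mu ^^ p) [a]) w)"
proof (induction w)
  case (Cons a w)
  then show ?case
    using mu_pow_append[of p "[a]" w] by simp
qed simp

lemma length_mu_pow [simp]: "length ((mu ^^ p) w) = 2 ^ p * length w"
  by (induction p) simp_all

lemma nth_mu:
  assumes "j < length w"
  shows "mu w ! (2 * j) = w ! j" and "mu w ! Suc (2 * j) = w ! j + 1"
proof -
  have "mu w ! (2 * j) = w ! j \<and> mu w ! Suc (2 * j) = w ! j + 1"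
    using assms
  proof (induction w arbitrary: j)
    case (Cons a w)
    then show ?case by (cases j) auto
  qed simp
  then show "mu w ! (2 * j) = w ! j" and "mu w ! Suc (2 * j) = w ! j + 1" by auto
qed

lemma mu_map_complement: "mu (map (\<lambda>a. a + 1) w) = map (\<lambda>a. a + 1) (mu w)"
  by (induction w) (simp_all del: add_bit_eq_xor)

lemma mu_pow_complement: "(mu ^^ p) [1] = map (\<lambda>a. a + 1) ((mu ^^ p) [0])"
proof (induction p)
  case (Suc p)
  then show ?case by (simp only: funpow.simps comp_apply mu_map_complement)
qed simp

text \<open>\<open>mu\<close> preserves the first letter, so that letter tells the iterated images
  of 0 and 1 apart.\<close>

lemma hd_mu_pow: "(mu ^^ p) [a] \<noteq> [] \<and> hd ((mu ^^ p) [a]) = a"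
proof (induction p)
  case (Suc p)
  then show ?case by (cases "(mu ^^ p) [a]") auto
qed simp

lemma mu_pow_letter_eq_iff: "(mu ^^ p) [a] = (mu ^^ p) [b] \<longleftrightarrow> a = b"
  by (metis hd_mu_pow)

lemma block_concat_map:
  assumes "\<And>a. length (g a) = l" and "i < length w"
  shows "block l (concat (map g w)) i = g (w ! i)"
  using assms(2)
proof (induction w arbitrary: i)
  case (Cons a w)
  then show ?case
    using assms(1) by (cases i) (auto simp: block_def)
qed simp

text \<open>The long word is the image under \<open>mu ^^ m\<close> of \<open>(mu ^^ m) [a]\<close>.
  Each letter of the latter has an image of length \<open>2 ^ m\<close>, and these images are the
  blocks in turn.\<close>

lemma block_mu_pow:
  assumes "i < 2 ^ m"
  shows "block (2 ^ m) ((mu ^^ (m + m)) [a]) i = (mu ^^ m) [(mu ^^ m) [a] ! i]"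
proof -
  have "(mu ^^ (m + m)) [a] = concat (map (\<lambda>b. (mu ^^ m) [b]) ((mu ^^ m) [a]))"
    using mu_pow_conv_concat[of m "(mu ^^ m) [a]"] by (simp add: funpow_add)
  then show ?thesis
    using block_concat_map[of "\<lambda>b. (mu ^^ m) [b]" "2 ^ m" i "(mu ^^ m) [a]"] assms by simp
qed

definition changes :: "bit list \<Rightarrow> nat" where
  "changes w = (\<Sum>i<length w - 1. of_bool (w ! i \<noteq> w ! Suc i))"

text \<open>Fits the adjacent pairs in \<open>mu v\<close>: index 0 is the pair inside the image of
  the first letter, \<open>2 * j + 1\<close> a pair across two images, \<open>2 * j + 2\<close> the
  pair inside the next image.\<close>

lemma sum_odd_length_pairs:
  fixes g :: "nat \<Rightarrow> 'a::comm_monoid_add"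
  assumes "L > 0"
  shows "(\<Sum>i<2 * L - 1. g i) = g 0 + (\<Sum>j<L - 1. g (Suc (2 * j)) + g (Suc (Suc (2 * j))))"
proof -
  obtain N where N: "L = Suc N" using assms by (cases L) auto
  have "(\<Sum>i<Suc (2 * N). g i) = g 0 + (\<Sum>j<N. g (Suc (2 * j)) + g (Suc (Suc (2 * j))))"
    by (induction N) (simp_all add: add.assoc)
  then show ?thesis by (simp add: N)
qed

lemma nth_mu_shift:
  assumes "j < length v - 1"
  shows "mu v ! Suc (2 * j) = v ! j + 1" and "mu v ! Suc (Suc (2 * j)) = v ! Suc j"
    and "mu v ! Suc (Suc (Suc (2 * j))) = v ! Suc j + 1"
  using nth_mu[of j v] nth_mu[of "Suc j" v] assms by simp_all

lemma bit_complement_eq_iff: "a + 1 = b \<longleftrightarrow> a \<noteq> b" for a b :: bit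
  by (cases a; cases b) simp_all

lemma bit_neq_complement: "a \<noteq> a + 1" for a :: bit
  by (cases a) simp_all

text \<open>Each image 01 or 10 has a change inside, and the last letter of an image is the
  complement of its source letter, so a change across two images occurs exactly where
  \<open>v\<close> has none.\<close>

lemma changes_mu:
  assumes "v \<noteq> []"
  shows "changes (mu v) + changes v + 1 = 2 * length v"
proof -
  let ?L = "length v"
  have L: "?L > 0" using assms by simp
  have "changes (mu v) = 1 + (\<Sum>j<?L - 1. of_bool (v ! j = v ! Suc j) + 1)"
    unfolding changes_def length_mu sum_odd_length_pairs[OF L]
  proof (intro arg_cong2[where f = "(+)"] sum.cong refl)
    show "of_bool (mu v ! 0 \<noteq> mu v ! Suc 0) = (1::nat)"
      using nth_mu[of 0 v] L bit_neq_complement by simp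
  qed (use bit_neq_complement in \<open>auto simp: nth_mu_shift bit_complement_eq_iff\<close>)
  moreover have "(\<Sum>j<?L - 1. of_bool (v ! j = v ! Suc j) + 1) + changes v = (\<Sum>j<?L - 1. 2)"
    unfolding changes_def sum.distrib[symmetric] by (intro sum.cong) auto
  ultimately show ?thesis using L by (cases v) simp_all
qed

text \<open>Solves the recurrence of \<open>changes_mu\<close>; the added 1 or 2 is the remainder of
  \<open>2 ^ Suc p\<close> modulo 3.\<close>

lemma changes_mu_pow:
  "3 * changes ((mu ^^ p) [a]) + (if even p then 2 else 1) = 2 ^ Suc p"
proof (induction p)
  case 0
  then show ?case by (simp add: changes_def)
next
  case (Suc p)
  have "changes ((mu ^^ Suc p) [a]) + changes ((mu ^^ p) [a]) + 1 = 2 ^ Suc p"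
    using changes_mu[of "(mu ^^ p) [a]"] hd_mu_pow by simp
  with Suc show ?case by (auto split: if_splits)
qed

lemma odd_agreements_mu:
  assumes "v \<noteq> []"
  shows "(\<Sum>i<2 * length v - 1. of_bool (odd i \<and> mu v ! i = mu v ! Suc i)) = changes v"
proof -
  have L: "length v > 0" using assms by simp
  show ?thesis
    unfolding changes_def sum_odd_length_pairs[OF L]
    by (auto intro!: sum.cong simp: nth_mu_shift bit_complement_eq_iff
        simp del: add_bit_eq_xor sum_of_bool_eq)
qed

lemma f_CS_Suc:
  "f_CS (Suc k) = 2 ^ 2 ^ k + int (changes ((mu ^^ (2 ^ k - 1)) [0])) * f_CS k"
proof -
  define m :: nat where "m = 2 ^ k"
  define v where "v = (mu ^^ (m - 1)) [0]"
  define w where "w = mu v"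
  \<comment> \<open>As \<open>m\<close> is positive, one \<open>mu\<close> splits off the iterate,
    which puts \<open>w\<close> in the form that \<open>odd_agreements_mu\<close> counts.\<close>
  have m: "m = Suc (m - 1)" by (simp add: m_def)
  have w_mu: "w = (mu ^^ m) [0]"
    by (subst m) (simp add: w_def v_def)
  have len_w: "length w = 2 ^ m" by (simp add: w_mu)
  have len_v: "2 * length v = 2 ^ m" using len_w by (simp add: w_def)
  have v: "v \<noteq> []" using hd_mu_pow by (simp add: v_def)
  define x where "x = block (2 ^ m) ((mu ^^ (m + m)) [0])"
  define y where "y = block (2 ^ m) ((mu ^^ (m + m)) [1])"
  define cs where
    "cs = (\<lambda>i. if even i then x i else if x i = y (i + 1) then x i else CS k)"
  have x: "x i = (mu ^^ m) [w ! i]" if "i < 2 ^ m" for i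
    using that by (simp add: x_def w_mu block_mu_pow)
  have y: "y i = (mu ^^ m) [w ! i + 1]" if "i < 2 ^ m" for i
    using that len_w unfolding y_def w_mu
    by (simp only: block_mu_pow) (simp only: mu_pow_complement nth_map)
  have len_cs: "int (length (cs i)) = 2 ^ m - of_bool (odd i \<and> w ! i = w ! Suc i) * f_CS k"
    if "i < 2 ^ m - 1" for i
  proof -
    have i: "i < 2 ^ m" "Suc i < 2 ^ m" using that by auto
    \<comment> \<open>\<open>y\<close> carries the complemented letters of \<open>w\<close>, so the
      two blocks differ exactly where \<open>w\<close> repeats a letter; for odd \<open>i\<close>
      this costs \<open>f_CS k\<close> letters.\<close>
    have "x i = y (i + 1) \<longleftrightarrow> w ! i \<noteq> w ! Suc i"
      using bit_complement_eq_iff[of "w ! Suc i" "w ! i"] i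
      by (auto simp: x y mu_pow_letter_eq_iff add.commute)
    moreover have "length (x i) = 2 ^ m" using i by (simp add: x)
    ultimately show ?thesis
      by (cases "even i") (simp_all add: cs_def f_CS_def m_def)
  qed
  have "CS (Suc k) = concat (map cs [0..<2 ^ m - 1])"
    unfolding cs_def x_def y_def m_def by (simp add: Let_def mult_2)
  then have "int (length (CS (Suc k))) = (\<Sum>i<2 ^ m - 1. int (length (cs i)))"
    by (simp add: length_concat comp_def sum_list_sum_nth atLeast0LessThan)
  also have "\<dots> = (\<Sum>i<2 ^ m - 1. 2 ^ m - of_bool (odd i \<and> w ! i = w ! Suc i) * f_CS k)"
    by (intro sum.cong) (simp_all add: len_cs)
  also have "\<dots> = int (2 ^ m - 1) * 2 ^ m
      - (\<Sum>i<2 ^ m - 1. of_bool (odd i \<and> w ! i = w ! Suc i)) * f_CS k"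
    by (simp add: sum_subtractf sum_distrib_right)
  also have "(\<Sum>i<2 ^ m - 1. of_bool (odd i \<and> w ! i = w ! Suc i)) = int (changes v)"
    unfolding odd_agreements_mu[OF v, symmetric] len_v w_def by simp
  finally have "int (length (CS (Suc k))) = (2 ^ m - 1) * 2 ^ m - int (changes v) * f_CS k"
    by (simp add: of_nat_diff)
  moreover have "(2::int) ^ 2 ^ Suc k = 2 ^ m * 2 ^ m"
    by (simp add: m_def mult_2 power_add)
  ultimately show ?thesis
    unfolding f_CS_def[of "Suc k"] m_def[symmetric] v_def[symmetric]
    by (simp only:) (simp add: left_diff_distrib)
qed

text \<open>Lets the upper bound on \<open>changes\<close> be multiplied by
  \<open>f_CS k\<close>.\<close>

lemma f_CS_nonneg: "f_CS k \<ge> 0"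
  by (induction k) (simp_all add: f_CS_Suc, simp add: f_CS_def)

lemma changes_prefix_le: "3 * changes ((mu ^^ (2 ^ k - 1)) [a]) \<le> 2 ^ 2 ^ k"
  using changes_mu_pow[of "2 ^ k - 1" a] by (simp split: if_splits)

lemma f_CS_Suc_le: "3 * f_CS (Suc k) \<le> 3 * 2 ^ 2 ^ k + 2 ^ 2 ^ k * f_CS k"
proof -
  have "int (3 * changes ((mu ^^ (2 ^ k - 1)) [0])) \<le> int (2 ^ 2 ^ k)"
    by (rule of_nat_mono) (rule changes_prefix_le)
  then show ?thesis
    using mult_right_mono[OF _ f_CS_nonneg[of k]] by (fastforce simp: f_CS_Suc algebra_simps)
qed

lemma f_CS_2_le: "f_CS 2 \<le> 6"
proof -
  have "f_CS 0 = 1" by (simp add: f_CS_def)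
  then have "f_CS 1 \<le> 2"
    using f_CS_Suc_le[of 0] by simp
  \<comment> \<open>The estimate \<open>f_CS_Suc_le\<close> is not sharp enough here; the integer \<open>c \<le> 4 / 3\<close> is at most 1.\<close>
  have "int (changes ((mu ^^ (2 ^ 1 - 1)) [0])) \<le> 1"
    using changes_prefix_le[of 1 0] by simp
  then have "int (changes ((mu ^^ (2 ^ 1 - 1)) [0])) * f_CS 1 \<le> 1 * 2"
    using \<open>f_CS 1 \<le> 2\<close> f_CS_nonneg by (intro mult_mono) auto
  then show ?thesis
    using f_CS_Suc[of 1] by (simp add: numeral_2_eq_2)
qed

text \<open>The theorem freed of \<open>powr\<close>, by \<open>2 powr log 2 3 = 3\<close>. From
  \<open>k\<close> to \<open>k + 1\<close> the main term is multiplied by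
  \<open>2 ^ 2 ^ k / 3\<close>, the factor of \<open>f_CS k\<close> in
  \<open>f_CS_Suc_le\<close>.\<close>

lemma f_CS_bound: "real_of_int (f_CS k) \<le> 8 * 2 ^ 2 ^ k / 3 ^ k - 6"
\<comment> \<open>At \<open>k = 1\<close> the number \<open>2 ^ 2 ^ k\<close> is 4, below 6, so the
  induction starts at 2, where the bound exceeds 8. At 0 and 1 the bound is 10 and 14/3, against
  values at most 1 and 2.\<close>
proof (cases "k \<ge> 2")
  case True
  then show ?thesis
  proof (induction k rule: dec_induct)
    case base
    then show ?case using f_CS_2_le by simp
  next
    case (step k)
    define B :: real where "B = 2 ^ 2 ^ k"
    have "(2::nat) ^ 2 \<le> 2 ^ k" using step.hyps by (intro power_increasing) auto
    then have "(2::real) ^ 4 \<le> B" unfolding B_def by (intro power_increasing) auto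
    then have B: "B \<ge> 6" by simp
    have "3 * real_of_int (f_CS (Suc k)) \<le> 3 * B + B * real_of_int (f_CS k)"
      using f_CS_Suc_le[of k, THEN of_int_le_iff[where 'a = real, THEN iffD2]] by (simp add: B_def)
    also have "\<dots> \<le> 3 * B + B * (8 * B / 3 ^ k - 6)"
      using B step.IH by (intro add_left_mono mult_left_mono) (auto simp: B_def)
    also have "\<dots> = 3 * (8 * B\<^sup>2 / 3 ^ Suc k - B)"
      by (simp add: field_simps power2_eq_square)
    also have "B\<^sup>2 = 2 ^ 2 ^ Suc k"
      by (simp add: B_def power_mult[symmetric] mult.commute)
    finally show ?case using B by simp
  qed
next
  case False
  have 0: "f_CS 0 = 1" by (simp add: f_CS_def)
  then have "f_CS 1 \<le> 2" using f_CS_Suc_le[of 0] by simp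
  moreover from False have "k = 0 \<or> k = 1" by auto
  ultimately show ?thesis using 0 by auto
qed

theorem theorem4:
  fixes k :: nat
  shows "real_of_int (f_CS k) \<le> 2 powr (2 ^ k - log 2 3 * real k + 3) - 6"
proof -
  have "(2::real) powr (log 2 3 * real k) = 3 ^ k"
    by (simp add: powr_powr[symmetric] powr_realpow)
  moreover have "(2::real) powr (2 ^ k) = 2 ^ 2 ^ k"
    using powr_realpow[of 2 "2 ^ k"] by simp
  ultimately have "2 powr (2 ^ k - log 2 3 * real k + 3) = 8 * 2 ^ 2 ^ k / (3::real) ^ k"
    by (simp add: powr_add powr_diff)
  then show ?thesis using f_CS_bound by simp
qed

end
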